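(* For every $m\in\mathbb{N}$, $$\mathrm{MARS}_m^+=\Bigl\{a\in\mathbb{C} : \operatorname{Im}\Bigl(\bigl(1+\tfrac{a}{m}\bigr)^{\ell+1}\overline{a}\Bigr)<0\ \text{for all } \ell\in\{0,\dots,m\},\ \operatorname{Im}(a)>0\Bigr\}$$ $$=\Bigl\{\xi+\mathrm{i}\eta : (\xi,\eta)\in\mathbb{R}\times(0,\infty),\ (m+1)\operatorname{arccot}\Bigl(\frac{\xi+m}{\eta}\Bigr)<\operatorname{arccot}\Bigl(\frac{\xi}{\eta}\Bigr)\Bigr\}.$$
   Context: $\mathbb{N}=\{1,2,\dots\}$. $\operatorname{arccot}$ denotes the continuous decreasing branch $\mathbb{R}\to(0,\pi)$ of the inverse cotangent. For $m\in\mathbb{N}$ and $a\in\mathbb{C}$, $\mathcal{M}_m(a)\in\mathbb{C}^{m\times m}$ is the matrix whose $i$-th row, for $1\le i\le m-1$, has entry $1$ in column $i+1$ and zeros elsewhere, and whose last row has all entries equal to $\frac{a}{m}$. $\sigma(\cdot)$ denotes the spectrum and $B_1(0)=\{z\in\mathbb{C}:|z|<1\}$. $\mathrm{MARS}_m:=\{a\in\mathbb{C}:\sigma(\mathcal{M}_m(a))\subseteq B_1(0)\}$ and $\mathrm{MARS}_m^+:=\{a\in\mathrm{MARS}_m:\operatorname{Im}(a)>0\}$. *)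

theory Defs
  imports Complex_Main "Jordan_Normal_Form.Spectral_Radius"
begin

text \<open>The branch of the inverse cotangent with values in \<open>(0, \<pi>)\<close>; the lemma below shows that
  the definite description is well defined on all of \<open>\<real>\<close>, continuous and decreasing.\<close>

definition arccot :: "real \<Rightarrow> real" where
  "arccot x = (THE y. 0 < y \<and> y < pi \<and> cot y = x)"

lemma arccot_eq: "arccot x = pi / 2 - arctan x"
  unfolding arccot_def
proof (rule the_equality)
  have "cot (pi / 2 - arctan x) = tan (arctan x)"
    by (simp add: cot_def tan_def sin_diff cos_diff)
  then show "0 < pi / 2 - arctan x \<and> pi / 2 - arctan x < pi \<and> cot (pi / 2 - arctan x) = x"
    using arctan_bounded[of x] by (simp add: tan_arctan)
next
  fix y assume y: "0 < y \<and> y < pi \<and> cot y = x"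
  have "tan (pi / 2 - y) = x"
    using y by (simp add: cot_def tan_def sin_diff cos_diff)
  then have "arctan x = pi / 2 - y"
    using y by (intro arctan_unique) auto
  then show "y = pi / 2 - arctan x"
    by simp
qed

text \<open>Rows and columns are indexed from \<open>0\<close>, so the last row has index \<open>m - 1\<close> and, in
  every row \<open>i < m - 1\<close>, the entry \<open>1\<close> is in column \<open>i + 1\<close>.\<close>

definition mars_mat :: "nat \<Rightarrow> complex \<Rightarrow> complex mat" where
  "mars_mat m a = mat m m (\<lambda>(i, j).
     if i = m - 1 then a / of_nat m else if j = i + 1 then 1 else 0)"

definition MARS :: "nat \<Rightarrow> complex set" where
  "MARS m = {a. spectrum (mars_mat m a) \<subseteq> {z. cmod z < 1}}"

definition MARS_plus :: "nat \<Rightarrow> complex set" where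
  "MARS_plus m = {a \<in> MARS m. Im a > 0}"

end

theory Submission
  imports Defs "HOL-Complex_Analysis.Complex_Analysis"
begin

text \<open>Put \<open>b = a / m\<close> and \<open>P w = w + \<dots> + w ^ m\<close>. Passing to reciprocals of eigenvalues, \<open>a\<close> lies
  in \<open>MARS\<close> iff \<open>1 / b\<close> is not in the image \<open>K\<close> of the closed unit disc under \<open>P\<close>. On the unit circle
  \<open>w P'(w) / P(w)\<close> has the constant real part \<open>(m + 1) / 2\<close>, so moving \<open>P w\<close> radially towards \<open>0\<close>
  moves \<open>w\<close> into the disc; hence \<open>K\<close> is star-shaped about \<open>0\<close>. On a ray of fixed \<open>arg b = \<phi>\<close> the
  angle \<open>\<theta> = arg (1 + b)\<close> increases with \<open>\<bar>b\<bar>\<close>, and \<open>1 / b = P w\<close> with \<open>\<bar>w\<bar> = 1\<close> is solvable iff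
  \<open>(1 + b) ^ (m + 1) * cnj b\<close> is real. So the instability threshold on the ray is the first
  such \<open>b\<close>, namely the one with \<open>(m + 1) * \<theta> = \<phi>\<close>.\<close>

no_notation fps_nth (infixl "$" 75)
no_notation vec_nth (infixl "$" 90)
no_notation scalar_prod (infix "\<bullet>" 70)

section \<open>Eigenvalue equation and its reciprocal form\<close>

text \<open>The exponents start at 1, so that \<open>z ^ m * power_sum m (inverse z)\<close> is the
  geometric sum of the eigenvalue equation and the value at 0 is 0.\<close>

definition power_sum :: "nat \<Rightarrow> complex \<Rightarrow> complex" where
  "power_sum m w = (\<Sum>k=1..m. w ^ k)"

text \<open>All rows but the last shift the entries, which forces an eigenvector for
  \<open>z\<close> to be a nonzero multiple of \<open>(1, z, ..., z ^ (m - 1))\<close>; the last row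
  then contributes the only remaining equation.\<close>

lemma eigenvalue_mars_mat_iff:
  assumes "m \<ge> 1"
  shows "eigenvalue (mars_mat m a) z \<longleftrightarrow> z ^ m = a / of_nat m * (\<Sum>k<m. z ^ k)"
proof
  assume "eigenvalue (mars_mat m a) z"
  then obtain v where v: "v \<in> carrier_vec m" "v \<noteq> 0\<^sub>v m" "mars_mat m a *\<^sub>v v = z \<cdot>\<^sub>v v"
    by (auto simp: eigenvalue_def eigenvector_def mars_mat_def)
  have row: "(\<Sum>j<m. mars_mat m a $$ (i, j) * v $ j) = z * v $ i" if "i < m" for i
  proof -
    have "(mars_mat m a *\<^sub>v v) $ i = z * v $ i" using v that by simp
    then show ?thesis using v(1) that
      by (simp add: mars_mat_def scalar_prod_def lessThan_atLeast0)
  qed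
  have step: "v $ Suc i = z * v $ i" if "Suc i < m" for i
  proof -
    have "z * v $ i = (\<Sum>j<m. if j = Suc i then v $ j else 0)"
      unfolding row[OF Suc_lessD[OF that], symmetric]
      by (intro sum.cong) (use that in \<open>auto simp: mars_mat_def\<close>)
    then show ?thesis using that by simp
  qed
  have vi: "v $ i = z ^ i * v $ 0" if "i < m" for i
    using that by (induction i) (auto simp: step)
  have v0: "v $ 0 \<noteq> 0"
  proof
    assume "v $ 0 = 0"
    then have "v $ i = 0" if "i < m" for i using vi[OF that] by simp
    then have "v = 0\<^sub>v m" using v(1) by (intro eq_vecI) auto
    then show False using v(2) by simp
  qed
  have last: "m - 1 < m" using assms by simp
  have "(\<Sum>j<m. a / of_nat m * v $ j) = z * v $ (m - 1)"
    unfolding row[OF last, symmetric]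
    by (intro sum.cong) (use assms in \<open>auto simp: mars_mat_def\<close>)
  moreover have "(\<Sum>j<m. a / of_nat m * v $ j) = a / of_nat m * (\<Sum>k<m. z ^ k) * v $ 0"
    unfolding sum_distrib_left sum_distrib_right
    by (intro sum.cong refl) (metis lessThan_iff mult.assoc vi)
  moreover have "z * v $ (m - 1) = z ^ m * v $ 0"
    using vi[of "m - 1"] assms by (cases m) auto
  ultimately show "z ^ m = a / of_nat m * (\<Sum>k<m. z ^ k)"
    using v0 by (metis mult_right_cancel)
next
  assume z: "z ^ m = a / of_nat m * (\<Sum>k<m. z ^ k)"
  define v where "v = Matrix.vec m (\<lambda>i. z ^ i)"
  \<comment> \<open>Entry 0 is \<open>z ^ 0 = 1\<close>, also for \<open>z = 0\<close>.\<close>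
  have "v $ 0 \<noteq> 0\<^sub>v m $ 0" using assms by (simp add: v_def)
  then have "v \<noteq> 0\<^sub>v m" by auto
  moreover have "mars_mat m a *\<^sub>v v = z \<cdot>\<^sub>v v"
  proof (rule eq_vecI)
    fix i assume "i < dim_vec (z \<cdot>\<^sub>v v)"
    then have i: "i < m" by (simp add: v_def)
    have "(mars_mat m a *\<^sub>v v) $ i = (\<Sum>j<m. mars_mat m a $$ (i, j) * z ^ j)"
      using i by (simp add: mars_mat_def scalar_prod_def lessThan_atLeast0 v_def)
    also have "\<dots> = z * z ^ i"
    proof (cases "i = m - 1")
      case True
      then have "(\<Sum>j<m. mars_mat m a $$ (i, j) * z ^ j) = a / of_nat m * (\<Sum>k<m. z ^ k)"
        unfolding sum_distrib_left by (intro sum.cong) (use i in \<open>auto simp: mars_mat_def\<close>)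
      then show ?thesis using z True assms by (cases m) auto
    next
      case False
      then have "(\<Sum>j<m. mars_mat m a $$ (i, j) * z ^ j) = (\<Sum>j<m. if j = Suc i then z ^ j else 0)"
        by (intro sum.cong) (use i in \<open>auto simp: mars_mat_def\<close>)
      then show ?thesis using i False by simp
    qed
    finally show "(mars_mat m a *\<^sub>v v) $ i = (z \<cdot>\<^sub>v v) $ i" using i by (simp add: v_def)
  qed (simp add: mars_mat_def v_def)
  moreover have "v \<in> carrier_vec m" by (simp add: v_def)
  moreover have "dim_row (mars_mat m a) = m" by (simp add: mars_mat_def)
  ultimately show "eigenvalue (mars_mat m a) z"
    unfolding eigenvalue_def eigenvector_def by metis
qed

lemma power_sum_inverse:
  assumes "z \<noteq> 0"
  shows "z ^ m * power_sum m (inverse z) = (\<Sum>k<m. z ^ k)"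
proof -
  have "z ^ m * power_sum m (inverse z) = (\<Sum>k=1..m. z ^ (m - k))"
    unfolding power_sum_def sum_distrib_left
    by (intro sum.cong) (use assms in \<open>auto simp: power_diff divide_inverse power_inverse\<close>)
  also have "\<dots> = (\<Sum>k<m. z ^ k)"
    by (rule sum.reindex_bij_witness[of _ "\<lambda>k. m - k" "\<lambda>k. m - k"]) auto
  finally show ?thesis .
qed

text \<open>Eigenvalues of modulus at least 1 correspond under \<open>w = inverse z\<close> to
  solutions in the punctured closed disc. The centre may be included because the power sum vanishes
  there.\<close>

lemma MARS_iff_power_sum:
  assumes "m \<ge> 1"
  shows "a \<in> MARS m \<longleftrightarrow> (\<forall>w\<in>cball 0 1. a / of_nat m * power_sum m w \<noteq> 1)"
proof -
  have eq: "z ^ m = a / of_nat m * (\<Sum>k<m. z ^ k) \<longleftrightarrow> a / of_nat m * power_sum m (inverse z) = 1"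
    if "z \<noteq> 0" for z
  proof -
    have "z ^ m = a / of_nat m * (\<Sum>k<m. z ^ k)
      \<longleftrightarrow> z ^ m * (a / of_nat m * power_sum m (inverse z)) = z ^ m * 1"
      unfolding power_sum_inverse[OF that, symmetric] by (auto simp: mult_ac)
    also have "\<dots> \<longleftrightarrow> a / of_nat m * power_sum m (inverse z) = 1"
      unfolding mult_cancel_left using that by auto
    finally show ?thesis .
  qed
  have "a \<in> MARS m \<longleftrightarrow> (\<forall>z. z ^ m = a / of_nat m * (\<Sum>k<m. z ^ k) \<longrightarrow> cmod z < 1)"
    unfolding MARS_def spectrum_def using eigenvalue_mars_mat_iff[OF assms] by auto
  also have "\<dots> \<longleftrightarrow> (\<forall>w\<in>cball 0 1. a / of_nat m * power_sum m w \<noteq> 1)"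
  proof (intro iffI ballI allI impI notI)
    fix w assume *: "\<forall>z. z ^ m = a / of_nat m * (\<Sum>k<m. z ^ k) \<longrightarrow> cmod z < 1"
      and w: "w \<in> cball 0 1" "a / of_nat m * power_sum m w = 1"
    have "w \<noteq> 0" using w(2) by (auto simp: power_sum_def power_0_left)
    then have "cmod (inverse w) < 1" using * eq[of "inverse w"] w(2) by simp
    then show False using w(1) \<open>w \<noteq> 0\<close> by (simp add: norm_inverse one_less_inverse_iff inverse_less_1_iff)
  next
    fix z assume *: "\<forall>w\<in>cball 0 1. a / of_nat m * power_sum m w \<noteq> 1"
      and z: "z ^ m = a / of_nat m * (\<Sum>k<m. z ^ k)"
    show "cmod z < 1"
    proof (rule ccontr)
      assume "\<not> cmod z < 1"
      then have "z \<noteq> 0" "inverse z \<in> cball 0 1" by (auto simp: norm_inverse inverse_le_1_iff)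
      then show False using * eq z by blast
    qed
  qed
  finally show ?thesis .
qed

section \<open>Identities for the power sum on the unit circle\<close>

lemma power_sum_mult: "(1 - w) * power_sum m w = w - w ^ (m + 1)"
proof (induction m)
  case (Suc m)
  have "(1 - w) * power_sum (Suc m) w = (1 - w) * power_sum m w + (1 - w) * w ^ Suc m"
    by (simp add: power_sum_def distrib_left)
  then show ?case unfolding Suc.IH by (simp add: algebra_simps)
qed (simp add: power_sum_def)

text \<open>On the circle \<open>cnj w\<close> is the reciprocal of \<open>w\<close>, so conjugating
  and multiplying by \<open>w ^ (m + 1)\<close> replaces the exponent \<open>k\<close> by
  \<open>m + 1 - k\<close>. The second sum is \<open>w\<close> times the derivative of the power
  sum.\<close>

lemma cnj_power_sum_circle:
  assumes "cmod w = 1"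
  shows "w ^ (m + 1) * cnj (power_sum m w) = power_sum m w"
    and "w ^ (m + 1) * cnj (\<Sum>k=1..m. of_nat k * w ^ k)
           = of_nat (m + 1) * power_sum m w - (\<Sum>k=1..m. of_nat k * w ^ k)"
proof -
  have refl: "w ^ (m + 1) * cnj w ^ k = w ^ (m + 1 - k)" if "k \<le> m" for k
  proof -
    have "w * cnj w = 1" using assms by (simp add: complex_norm_square[symmetric])
    then have "w ^ k * cnj w ^ k = 1" by (simp flip: power_mult_distrib)
    moreover have "w ^ (m + 1) = w ^ (m + 1 - k) * w ^ k"
      using that by (simp flip: power_add)
    ultimately show ?thesis by (simp add: mult.assoc)
  qed
  have "w ^ (m + 1) * cnj (power_sum m w) = (\<Sum>k=1..m. w ^ (m + 1) * cnj w ^ k)"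
    by (simp add: power_sum_def sum_distrib_left)
  also have "\<dots> = (\<Sum>k=1..m. w ^ (m + 1 - k))"
    by (intro sum.cong refl) auto
  also have "\<dots> = power_sum m w" unfolding power_sum_def
    by (rule sum.reindex_bij_witness[of _ "\<lambda>k. m + 1 - k" "\<lambda>k. m + 1 - k"]) auto
  finally show "w ^ (m + 1) * cnj (power_sum m w) = power_sum m w" .
  have "w ^ (m + 1) * cnj (\<Sum>k=1..m. of_nat k * w ^ k) =
      (\<Sum>k=1..m. of_nat k * (w ^ (m + 1) * cnj w ^ k))"
    by (simp add: sum_distrib_left mult_ac)
  also have "\<dots> = (\<Sum>k=1..m. of_nat k * w ^ (m + 1 - k))"
    by (intro sum.cong arg_cong2[of _ _ _ _ "(*)"] refl) auto
  also have "\<dots> = (\<Sum>k=1..m. of_nat (m + 1 - k) * w ^ k)"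
    by (rule sum.reindex_bij_witness[of _ "\<lambda>k. m + 1 - k" "\<lambda>k. m + 1 - k"]) auto
  also have "\<dots> = (\<Sum>k=1..m. of_nat (m + 1) * w ^ k - of_nat k * w ^ k)"
    by (intro sum.cong) (auto simp: of_nat_diff algebra_simps)
  also have "\<dots> = of_nat (m + 1) * power_sum m w - (\<Sum>k=1..m. of_nat k * w ^ k)"
    by (simp only: sum_subtractf power_sum_def sum_distrib_left)
  finally show "w ^ (m + 1) * cnj (\<Sum>k=1..m. of_nat k * w ^ k)
    = of_nat (m + 1) * power_sum m w - (\<Sum>k=1..m. of_nat k * w ^ k)" .
qed

text \<open>Dividing the two reflection identities shows that conjugation sends \<open>D / P\<close>
  to \<open>(m + 1) - D / P\<close>, which fixes the real part.\<close>

lemma Re_logderiv_power_sum_circle: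
  assumes "cmod w = 1" "power_sum m w \<noteq> 0"
  shows "Re ((\<Sum>k=1..m. of_nat k * w ^ k) / power_sum m w) = (real m + 1) / 2"
proof -
  define D where "D = (\<Sum>k=1..m. of_nat k * w ^ k)"
  define P where "P = power_sum m w"
  have w: "w \<noteq> 0" using assms(1) by auto
  have "cnj (D / P) = (w ^ (m + 1) * cnj D) / (w ^ (m + 1) * cnj P)"
    using w by simp
  also have "\<dots> = (of_nat (m + 1) * P - D) / P"
    using cnj_power_sum_circle[OF assms(1), of m] by (simp only: D_def P_def)
  also have "\<dots> = of_nat (m + 1) - D / P"
    using assms(2) by (simp add: P_def diff_divide_distrib)
  finally have "D / P + cnj (D / P) = of_nat (m + 1)" by simp
  then have "2 * Re (D / P) = real m + 1"
    by (simp only: complex_add_cnj) (metis Re_complex_of_real of_real_of_nat_eq of_nat_Suc Suc_eq_plus1 add.commute)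
  then show ?thesis by (simp add: D_def P_def)
qed

section \<open>Star-shape of the image of the closed disc\<close>

lemma power_sum_has_derivative:
  "(power_sum m has_field_derivative (\<Sum>k=1..m. of_nat k * w ^ (k - 1))) (at w)"
  unfolding power_sum_def [abs_def] by (auto intro!: derivative_eq_intros sum.cong)

lemma holomorphic_power_sum: "power_sum m holomorphic_on S"
  unfolding power_sum_def [abs_def] by (intro holomorphic_intros)

lemma continuous_on_power_sum: "continuous_on S (power_sum m)"
  by (intro holomorphic_on_imp_continuous_on holomorphic_power_sum)

lemma power_sum_not_constant:
  assumes "m \<ge> 1"
  shows "\<not> power_sum m constant_on ball 0 1"
proof
  assume "power_sum m constant_on ball 0 1"
  then obtain c where c: "\<And>w. w \<in> ball 0 1 \<Longrightarrow> power_sum m w = c"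
    by (auto simp: constant_on_def)
  have "power_sum m (complex_of_real (1/2)) = power_sum m 0"
    using c[of "complex_of_real (1/2)"] c[of 0] by simp
  moreover have "power_sum m 0 = 0" by (auto simp: power_sum_def power_0_left)
  moreover have "power_sum m (complex_of_real (1/2)) = of_real (\<Sum>k=1..m. (1/2) ^ k)"
    by (simp add: power_sum_def)
  ultimately have "(\<Sum>k=1..m. (1/2::real) ^ k) = 0"
    by (metis of_real_eq_0_iff)
  moreover have "(\<Sum>k=1..m. (1/2::real) ^ k) > 0"
    using assms by (intro sum_pos) auto
  ultimately show False by linarith
qed

lemma open_power_sum_ball:
  assumes "m \<ge> 1"
  shows "open (power_sum m ` ball 0 1)"
  by (rule open_mapping_thm[OF holomorphic_power_sum _ _ _ _ power_sum_not_constant[OF assms]]) auto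

lemma open_eventually_of_real_mult:
  assumes "open U" "(v::complex) \<in> U"
  shows "eventually (\<lambda>s. of_real s * v \<in> U) (at 1)"
proof -
  have "((\<lambda>s. of_real s * v) \<longlongrightarrow> of_real 1 * v) (at (1::real))"
    by (intro tendsto_intros)
  then show ?thesis using assms by (auto dest: topological_tendstoD)
qed

text \<open>For interior \<open>w\<close> this is the open mapping theorem. For \<open>w\<close> on
  the circle, a local inverse follows the point as its image is scaled, and the positive real part
  of the logarithmic derivative makes the modulus of the preimage fall below 1 for \<open>s\<close>
  slightly less than 1.\<close>

lemma power_sum_image_shrink:
  assumes m: "m \<ge> 1" and w: "cmod w \<le> 1" "power_sum m w \<noteq> 0"
  shows "eventually (\<lambda>s. of_real s * power_sum m w \<in> power_sum m ` cball 0 1) (at_left (1::real))"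
proof (cases "cmod w < 1")
  case True
  then have "power_sum m w \<in> power_sum m ` ball 0 1" by auto
  from open_eventually_of_real_mult[OF open_power_sum_ball[OF m] this]
  have "eventually (\<lambda>s. of_real s * power_sum m w \<in> power_sum m ` ball 0 1) (at_left (1::real))"
    by (simp add: eventually_at_split)
  then show ?thesis by eventually_elim (use ball_subset_cball in blast)
next
  case False
  then have w1: "cmod w = 1" using w by simp
  then have w0: "w \<noteq> 0" by auto
  define P where "P = power_sum m w"
  define d where "d = (\<Sum>k=1..m. of_nat k * w ^ (k - 1))"
  have "w * d = (\<Sum>k=1..m. of_nat k * w ^ k)"
    unfolding d_def sum_distrib_left
    by (intro sum.cong) (auto simp: mult_ac power_eq_if)
  with Re_logderiv_power_sum_circle[OF w1 w(2)]
  have Re: "Re (w * d / P) = (real m + 1) / 2" by (simp add: P_def)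
  \<comment> \<open>A vanishing derivative would give real part 0, not
    \<open>(m + 1) / 2\<close>.\<close>
  then have d0: "d \<noteq> 0" by auto
  have "deriv (power_sum m) w \<noteq> 0"
    using DERIV_imp_deriv[OF power_sum_has_derivative, of m w] d0 by (simp add: d_def)
  then obtain r where r: "r > 0" "inj_on (power_sum m) (ball w r)"
    using has_complex_derivative_locally_injective[OF holomorphic_power_sum, of w UNIV m] by auto
  define U where "U = power_sum m ` ball w r"
  have "open U" unfolding U_def
    by (rule open_mapping_thm3[OF holomorphic_power_sum _ r(2)]) auto
  moreover have PU: "P \<in> U" using r(1) by (auto simp: U_def P_def)
  ultimately have U: "eventually (\<lambda>s. of_real s * P \<in> U) (at_left (1::real))"
    using open_eventually_of_real_mult by (auto simp: eventually_at_split)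
  define g where "g = inv_into (ball w r) (power_sum m)"
  have gf: "g (power_sum m z) = z" if "z \<in> ball w r" for z
    using r(2) that by (simp add: g_def inv_into_f_f)
  have fg: "power_sum m (g v) = v" if "v \<in> U" for v
    using that by (auto simp: U_def gf)
  \<comment> \<open>The point is written \<open>of_real 1 * P\<close> to match the path
    \<open>of_real s * P\<close> at \<open>s = 1\<close> in the chain rule.\<close>
  have "(g has_field_derivative inverse d) (at (of_real 1 * P))"
    using has_field_derivative_inverse_strong[OF power_sum_has_derivative, of w m "ball w r" g]
      d0 r(1) gf continuous_on_power_sum by (simp add: P_def d_def)
  moreover have "((\<lambda>s. of_real s * P) has_vector_derivative P) (at 1)"
    by (auto intro!: derivative_eq_intros)
  ultimately have "(g \<circ> (\<lambda>s. of_real s * P) has_vector_derivative P * inverse d) (at 1)"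
    by (intro field_vector_diff_chain_at)
  then have G: "((\<lambda>s. g (of_real s * P)) has_derivative (\<lambda>h. h *\<^sub>R (P * inverse d))) (at 1)"
    by (simp add: has_vector_derivative_def o_def)
  have "((\<lambda>s. g (of_real s * P) \<bullet> g (of_real s * P)) has_derivative
      (\<lambda>h. (2 * (w \<bullet> (P * inverse d))) * h)) (at 1)"
    using has_derivative_inner[OF G G] gf[of w] r(1)
    by (simp add: P_def inner_commute algebra_simps)
  then have deriv: "((\<lambda>s. g (of_real s * P) \<bullet> g (of_real s * P)) has_field_derivative
      2 * (w \<bullet> (P * inverse d))) (at 1)"
    by (simp add: has_field_derivative_def)
  \<comment> \<open>The velocity of the preimage at \<open>s = 1\<close> is \<open>w\<close> times
    the reciprocal of the logarithmic derivative; its inner product with \<open>w\<close> is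
    therefore the real part of that reciprocal, since \<open>w * cnj w = 1\<close>.\<close>
  have "P * inverse d = w * inverse (w * d / P)"
    using w0 d0 w(2) by (simp add: P_def field_simps)
  moreover have "w \<bullet> (w * y) = Re (w * cnj w * cnj y)" for y
    by (simp add: inner_complex_def algebra_simps)
  ultimately have "w \<bullet> (P * inverse d) = Re (w * cnj w * cnj (inverse (w * d / P)))"
    by presburger
  also have "w * cnj w = 1" using w1 by (simp add: complex_norm_square[symmetric])
  also have "Re (1 * cnj (inverse (w * d / P))) > 0"
  proof -
    have "Re (inverse z) > 0" if "Re z > 0" for z
      using that by (auto intro!: divide_pos_pos add_pos_nonneg)
    from this[of "w * d / P"] show ?thesis unfolding mult_1 cnj.sel Re by simp
  qed
  finally have "2 * (w \<bullet> (P * inverse d)) > 0" by simp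
  from DERIV_pos_inc_left[OF deriv this] obtain e where e: "e > 0"
    "\<And>h. 0 < h \<Longrightarrow> h < e \<Longrightarrow> g (of_real (1 - h) * P) \<bullet> g (of_real (1 - h) * P) < g P \<bullet> g P"
    by auto
  have "eventually (\<lambda>s. s \<in> {1 - e<..<1}) (at_left (1::real))"
    using e(1) by (intro eventually_at_leftI[of "1 - e"]) auto
  with U show ?thesis
  proof eventually_elim
    case (elim s)
    have "g P = w" using gf[of w] r(1) by (simp add: P_def)
    with e(2)[of "1 - s"] elim w1 have "g (of_real s * P) \<bullet> g (of_real s * P) < 1"
      by (simp add: dot_square_norm)
    then have "cmod (g (of_real s * P)) < 1"
      by (simp add: dot_square_norm power_less_one_iff)
    then show ?case using fg elim by (metis P_def image_eqI mem_cball_0 less_imp_le)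
  qed
qed

text \<open>Compactness turns the local shrinking into a global one: the least admissible scaling in
  \<open>{s..1}\<close> exists, and if it exceeded \<open>s\<close> it could be lowered
  further.\<close>

lemma power_sum_image_starlike:
  assumes m: "m \<ge> 1" and v: "v \<in> power_sum m ` cball 0 1" and s: "0 < s" "s \<le> 1"
  shows "of_real s * v \<in> power_sum m ` cball 0 1"
proof (cases "v = 0")
  case False
  define K where "K = power_sum m ` cball 0 1"
  define C where "C = (\<lambda>r. of_real r * v) -` K \<inter> {s..1}"
  have "closed K" unfolding K_def
    by (intro compact_imp_closed compact_continuous_image continuous_on_power_sum compact_cball)
  then have "closed C" unfolding C_def
    by (intro continuous_closed_preimage_constant continuous_closed_vimage continuous_intros closed_Int) auto
  then have "compact C"
    by (metis C_def bounded_closed_interval bounded_Int compact_eq_bounded_closed)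
  moreover have "1 \<in> C" using v s by (simp add: C_def K_def)
  ultimately obtain r where r: "r \<in> C" "\<And>t. t \<in> C \<Longrightarrow> r \<le> t"
    using compact_attains_inf[of C] by auto
  then obtain w where w: "cmod w \<le> 1" "power_sum m w = of_real r * v" and rs: "s \<le> r" "r \<le> 1"
    by (auto simp: C_def K_def)
  have "r = s"
  proof (rule ccontr)
    assume "r \<noteq> s"
    then have "s / r < 1" using rs s by (simp add: field_simps)
    have "power_sum m w \<noteq> 0" using w False rs s by auto
    from power_sum_image_shrink[OF m w(1) this]
    have "eventually (\<lambda>t. of_real t * (of_real r * v) \<in> K) (at_left (1::real))"
      by (simp add: w K_def)
    moreover have "eventually (\<lambda>t. t \<in> {s / r<..<1}) (at_left (1::real))"
      using \<open>s / r < 1\<close> by (intro eventually_at_leftI[of "s / r"]) auto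
    ultimately have "eventually (\<lambda>t. of_real t * (of_real r * v) \<in> K \<and> t \<in> {s / r<..<1}) (at_left (1::real))"
      by (rule eventually_conj)
    then obtain t where t: "of_real t * (of_real r * v) \<in> K" "t \<in> {s / r<..<1}"
      using eventually_happens'[OF trivial_limit_at_left_real] by blast
    \<comment> \<open>The bound \<open>t > s / r\<close> keeps the smaller scaling
      \<open>t * r\<close> inside \<open>{s..1}\<close>.\<close>
    then have "s < t * r" "t * r < r" using rs s by (auto simp: field_simps)
    moreover have "t * r \<in> C" using t calculation rs by (auto simp: C_def mult.assoc)
    ultimately show False using r(2)[of "t * r"] by linarith
  qed
  then show ?thesis using r(1) by (simp add: C_def K_def)
qed (use v in simp)

section \<open>Circle solutions and the reality condition\<close>

text \<open>Reflection gives \<open>cnj b = w ^ (m + 1) * b\<close>, and the telescoped sum then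
  gives \<open>cnj (1 + b) = w * (1 + b)\<close>. Together they make the product equal to its own
  conjugate.\<close>

lemma Im_power_circle_eq_0:
  assumes "cmod w = 1" "b * power_sum m w = 1"
  shows "Im ((1 + b) ^ (m + 1) * cnj b) = 0"
proof -
  have w0: "w \<noteq> 0" and b0: "b \<noteq> 0" using assms by auto
  have P: "power_sum m w = inverse b" using assms(2) b0 by (simp add: field_simps)
  have "w ^ (m + 1) * cnj (inverse b) = inverse b"
    using cnj_power_sum_circle(1)[OF assms(1), of m] by (simp only: P)
  then have cb: "cnj b = w ^ (m + 1) * b" using b0 by (simp add: field_simps)
  have "(1 - w) * inverse b = w - w ^ (m + 1)"
    using power_sum_mult[of w m] by (simp only: P)
  then have "1 - w = (w - w ^ (m + 1)) * b" using b0 by (simp add: field_simps)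
  then have c: "cnj (1 + b) = w * (1 + b)" using cb by (simp add: algebra_simps)
  have "cnj ((1 + b) ^ (m + 1) * cnj b) = (w * (1 + b)) ^ (m + 1) * b"
    by (simp only: c[symmetric] complex_cnj_mult complex_cnj_power complex_cnj_cnj)
  also have "\<dots> = (1 + b) ^ (m + 1) * cnj b"
    by (simp only: cb power_mult_distrib mult_ac)
  finally show ?thesis by (metis Reals_cnj_iff complex_is_Real_iff)
qed

lemma Im_power_eq_0_imp_circle:
  assumes b: "Im b > 0" and eq: "Im ((1 + b) ^ (m + 1) * cnj b) = 0"
  obtains w where "cmod w = 1" "power_sum m w = inverse b"
proof
  define c where "c = 1 + b"
  have c0: "c \<noteq> 0" and b0: "b \<noteq> 0" and cc: "c - cnj c \<noteq> 0"
    using b by (auto simp: c_def complex_eq_iff)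
  \<comment> \<open>The relation \<open>cnj (1 + b) = w * (1 + b)\<close>, necessary for any
    solution on the circle, leaves only this candidate. It differs from 1 because
    \<open>Im b > 0\<close>, so the factor \<open>1 - w\<close> can be cancelled at the end.\<close>
  define w where "w = cnj c / c"
  show "cmod w = 1" using c0 by (simp add: w_def norm_divide)
  have "cnj (c ^ (m + 1) * cnj b) = c ^ (m + 1) * cnj b"
    using eq by (metis Reals_cnj_iff complex_is_Real_iff c_def)
  then have "w ^ (m + 1) = cnj b / b"
    using c0 b0 by (simp add: w_def field_simps)
  then have "(1 - w) * power_sum m w = cnj c / c - cnj b / b"
    by (simp add: power_sum_mult w_def)
  also have "\<dots> = (1 - w) * inverse b"
    using c0 b0 by (simp add: w_def field_simps) (simp add: c_def algebra_simps)
  finally show "power_sum m w = inverse b"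
    using cc c0 by (simp add: w_def)
qed

section \<open>Arguments in the upper half-plane and the sign conditions\<close>

lemma arccot_bounds: "0 < arccot x" "arccot x < pi"
  using arctan_bounded[of x] by (auto simp: arccot_eq)

lemma arccot_less_iff: "arccot x < arccot y \<longleftrightarrow> y < x"
  by (simp add: arccot_eq arctan_less_iff)

lemma arccot_cot:
  assumes "0 < x" "x < pi"
  shows "arccot (cot x) = x"
proof -
  have "cot x = tan (pi / 2 - x)" by (simp add: cot_def tan_def sin_diff cos_diff)
  then show ?thesis using assms by (simp add: arccot_eq arctan_tan)
qed

text \<open>Identifies the arccot of the quotient with the argument in \<open>(0, pi)\<close>, so
  that De Moivre turns the imaginary parts into sines.\<close>

lemma rcis_arccot:
  assumes "Im z > 0"
  shows "z = rcis (cmod z) (arccot (Re z / Im z))"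
proof -
  have "sqrt (1 + (Re z / Im z)\<^sup>2) = sqrt ((cmod z / Im z)\<^sup>2)"
    using assms by (simp add: cmod_power2 field_simps)
  also have "\<dots> = cmod z / Im z" using assms by simp
  finally have "sqrt (1 + (Re z / Im z)\<^sup>2) = cmod z / Im z" .
  moreover have "cmod z \<noteq> 0" using assms by auto
  ultimately show ?thesis using assms
    by (simp add: complex_eq_iff arccot_eq sin_diff cos_diff sin_arctan cos_arctan)
qed

lemma Im_power_mult_cnj:
  assumes "Im b > 0"
  shows "Im ((1 + b) ^ n * cnj b) = cmod (1 + b) ^ n * cmod b *
    sin (real n * arccot ((Re b + 1) / Im b) - arccot (Re b / Im b))"
proof -
  define \<theta> where "\<theta> = arccot ((Re b + 1) / Im b)"
  define \<phi> where "\<phi> = arccot (Re b / Im b)"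
  have "1 + b = rcis (cmod (1 + b)) \<theta>"
    using rcis_arccot[of "1 + b"] assms by (simp add: \<theta>_def add.commute)
  moreover have "cnj b = rcis (cmod b) (- \<phi>)"
    using arg_cong[OF rcis_arccot[OF assms], of cnj] by (simp add: \<phi>_def rcis_def cis_cnj)
  ultimately have "(1 + b) ^ n * cnj b = rcis (cmod (1 + b) ^ n * cmod b) (real n * \<theta> - \<phi>)"
    by (metis DeMoivre2 rcis_mult add_uminus_conv_diff)
  then show ?thesis by (simp add: \<theta>_def \<phi>_def)
qed

text \<open>The sign is that of \<open>sin ((l + 1) * \<theta> - \<phi>)\<close>. The angle starts
  in \<open>(-pi, 0)\<close> and grows by \<open>\<theta> < pi\<close> with each \<open>l\<close>,
  so it cannot jump over \<open>[0, pi]\<close>, where the sine is nonnegative. Hence negativity for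
  all \<open>l\<close> up to \<open>m\<close> means that the last angle is still below 0.\<close>

lemma Im_power_less_0_iff:
  assumes "Im b > 0"
  shows "(\<forall>l\<in>{0..m}. Im ((1 + b) ^ (l + 1) * cnj b) < 0) \<longleftrightarrow>
    (real m + 1) * arccot ((Re b + 1) / Im b) < arccot (Re b / Im b)"
proof -
  define \<theta> where "\<theta> = arccot ((Re b + 1) / Im b)"
  define \<phi> where "\<phi> = arccot (Re b / Im b)"
  have \<theta>: "0 < \<theta>" and \<phi>: "\<phi> < pi" "\<theta> < \<phi>"
    using arccot_bounds assms by (auto simp: \<theta>_def \<phi>_def arccot_less_iff divide_strict_right_mono)
  have "1 + b \<noteq> 0" "b \<noteq> 0" using assms by (auto simp: complex_eq_iff)
  then have Im_iff: "Im ((1 + b) ^ (l + 1) * cnj b) < 0 \<longleftrightarrow> sin (real (l + 1) * \<theta> - \<phi>) < 0" for l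
    unfolding Im_power_mult_cnj[OF assms] \<theta>_def[symmetric] \<phi>_def[symmetric]
    by (simp add: mult_less_0_iff zero_less_mult_iff del: of_nat_add)
  have "real (l + 1) * \<theta> < \<phi>"
    if neg: "\<forall>l\<in>{0..m}. sin (real (l + 1) * \<theta> - \<phi>) < 0" and "l \<le> m" for l
    using \<open>l \<le> m\<close>
  proof (induction l)
    case (Suc l)
    show ?case
    proof (rule ccontr)
      assume "\<not> ?thesis"
      moreover have "real (Suc l + 1) * \<theta> - \<phi> \<le> pi"
        using Suc \<phi> by (simp add: algebra_simps)
      ultimately have "sin (real (Suc l + 1) * \<theta> - \<phi>) \<ge> 0"
        by (intro sin_ge_zero) auto
      then show False using neg Suc.prems by force
    qed
  qed (use \<phi> in simp)
  moreover have "sin (real (l + 1) * \<theta> - \<phi>) < 0" if "real (m + 1) * \<theta> < \<phi>" "l \<le> m" for l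
  proof -
    have "real (l + 1) * \<theta> \<le> real (m + 1) * \<theta>" using that \<theta> by (intro mult_right_mono) auto
    moreover have "0 < real (l + 1) * \<theta>" using \<theta> by simp
    ultimately have "0 < sin (\<phi> - real (l + 1) * \<theta>)"
      using that \<phi> by (intro sin_gt_zero) linarith+
    then show ?thesis by (metis minus_diff_eq sin_minus neg_less_0_iff_less)
  qed
  ultimately have "(\<forall>l\<in>{0..m}. sin (real (l + 1) * \<theta> - \<phi>) < 0) \<longleftrightarrow> real (m + 1) * \<theta> < \<phi>"
    by fastforce
  then show ?thesis
    unfolding Im_iff by (simp add: \<theta>_def \<phi>_def add.commute)
qed

section \<open>The stability threshold on a ray\<close>

text \<open>If \<open>inverse b\<close> were in the image, moving outward along its ray would reach
  a last image point, attained on the circle. There the imaginary part for exponent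
  \<open>m + 1\<close> is 0, whereas the angle inequality survives the move and makes it
  negative.\<close>

lemma arccot_less_imp_inverse_notin_image:
  assumes m: "m \<ge> 1" and b: "Im b > 0"
    and less: "(real m + 1) * arccot ((Re b + 1) / Im b) < arccot (Re b / Im b)"
  shows "inverse b \<notin> power_sum m ` cball 0 1"
proof
  define K where "K = power_sum m ` cball 0 1"
  assume "inverse b \<in> power_sum m ` cball 0 1"
  then have bK: "inverse b \<in> K" by (simp add: K_def)
  have b0: "b \<noteq> 0" using b by auto
  have "compact K" unfolding K_def
    by (intro compact_continuous_image continuous_on_power_sum compact_cball)
  \<comment> \<open>The real numbers \<open>r \<ge> 1\<close> with \<open>r / b \<in> K\<close>; by openness of \<open>P\<close> the largest one is attained on the
    circle.\<close>
  define C where "C = {1..} \<inter> (\<lambda>v. Re (v * b)) ` (K \<inter> {v. Im (v * b) = 0})"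
  have "compact C" unfolding C_def
    by (intro closed_Int_compact closed_atLeast compact_continuous_image compact_Int_closed \<open>compact K\<close>
        closed_Collect_eq continuous_intros)
  moreover have "1 \<in> C" unfolding C_def
    by (intro IntI image_eqI[of _ _ "inverse b"]) (use bK b0 in auto)
  ultimately obtain r where r: "r \<in> C" "\<And>t. t \<in> C \<Longrightarrow> t \<le> r"
    using compact_attains_sup[of C] by auto
  then obtain w where "cmod w \<le> 1" "Im (power_sum m w * b) = 0" "r = Re (power_sum m w * b)" "r \<ge> 1"
    by (auto simp: C_def K_def)
  then have w: "cmod w \<le> 1" "power_sum m w * b = of_real r" and r1: "r \<ge> 1"
    by (auto simp: complex_eq_iff)
  have "cmod w = 1"
  proof (rule ccontr)
    assume "cmod w \<noteq> 1"
    then have "power_sum m w \<in> power_sum m ` ball 0 1" using w by auto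
    \<comment> \<open>An interior preimage would allow a scaling by some \<open>s > 1\<close>,
      contradicting the maximality of \<open>r\<close>.\<close>
    from open_eventually_of_real_mult[OF open_power_sum_ball[OF m] this]
    have "eventually (\<lambda>s. of_real s * power_sum m w \<in> power_sum m ` ball 0 1) (at_right (1::real))"
      by (simp add: eventually_at_split)
    moreover have "eventually (\<lambda>s. s > 1) (at_right (1::real))"
      by (simp add: eventually_at_right_less)
    ultimately have "eventually (\<lambda>s. of_real s * power_sum m w \<in> power_sum m ` ball 0 1 \<and> s > 1) (at_right (1::real))"
      by (rule eventually_conj)
    then obtain s where s: "of_real s * power_sum m w \<in> power_sum m ` ball 0 1" "s > 1"
      using eventually_happens'[OF trivial_limit_at_right_real] by blast
    then have "of_real s * power_sum m w \<in> K" using ball_subset_cball by (auto simp: K_def)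
    moreover have eq: "of_real s * power_sum m w * b = of_real (s * r)"
      using w(2) by (simp add: mult.assoc)
    moreover have "s * r \<ge> 1" using s r1 mult_mono[of 1 s 1 r] by simp
    ultimately have "s * r \<in> C" unfolding C_def
      by (intro IntI image_eqI[of _ _ "of_real s * power_sum m w"])
        (simp_all only: eq mem_Collect_eq Re_complex_of_real Im_complex_of_real Int_iff atLeast_iff)
    then have "s * r \<le> r" by (rule r)
    then show False using s r1 by simp
  qed
  define b' where "b' = b / of_real r"
  have "b' * power_sum m w = 1" using w(2) r1 by (simp add: b'_def mult.commute)
  then have "Im ((1 + b') ^ (m + 1) * cnj b') = 0"
    using \<open>cmod w = 1\<close> by (rule Im_power_circle_eq_0[rotated])
  moreover have "(real m + 1) * arccot ((Re b' + 1) / Im b') < arccot (Re b' / Im b')"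
  proof -
    \<comment> \<open>Dividing \<open>b\<close> by \<open>r \<ge> 1\<close> keeps its argument and
      does not increase that of \<open>1 + b\<close>.\<close>
    have "(Re b + 1) / Im b \<le> (Re b' + 1) / Im b'"
      using b r1 by (simp add: b'_def field_simps)
    then have "arccot ((Re b' + 1) / Im b') \<le> arccot ((Re b + 1) / Im b)"
      by (simp add: arccot_less_iff flip: not_less)
    then have "(real m + 1) * arccot ((Re b' + 1) / Im b') \<le> (real m + 1) * arccot ((Re b + 1) / Im b)"
      by (intro mult_left_mono) auto
    also have "\<dots> < arccot (Re b' / Im b')" using less r1 by (simp add: b'_def)
    finally show ?thesis .
  qed
  moreover have "Im b' > 0" using b r1 by (simp add: b'_def)
  ultimately show False using Im_power_less_0_iff[of b' m] by force
qed

text \<open>If the inequality fails, the threshold point \<open>b'\<close> lies on the segment from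
  0 to \<open>b\<close>. Its reciprocal is attained on the circle, and star-shape carries this
  inward to \<open>inverse b\<close>.\<close>

lemma inverse_notin_image_imp_arccot_less:
  assumes m: "m \<ge> 1" and b: "Im b > 0"
    and notin: "inverse b \<notin> power_sum m ` cball 0 1"
  shows "(real m + 1) * arccot ((Re b + 1) / Im b) < arccot (Re b / Im b)"
proof (rule ccontr)
  define \<phi> where "\<phi> = arccot (Re b / Im b)"
  define \<alpha> where "\<alpha> = \<phi> / (real m + 1)"
  define x where "x = cot \<alpha>"
  \<comment> \<open>The scaling for which \<open>arg (1 + t b) = \<alpha>\<close>.\<close>
  define t where "t = inverse (x * Im b - Re b)"
  assume "\<not> ?thesis"
  then have ge: "\<alpha> \<le> arccot ((Re b + 1) / Im b)" by (simp add: \<alpha>_def \<phi>_def field_simps)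
  have \<phi>: "0 < \<phi>" "\<phi> < pi" using arccot_bounds by (auto simp: \<phi>_def)
  then have \<alpha>: "0 < \<alpha>" "\<alpha> < \<phi>" using m by (auto simp: \<alpha>_def field_simps)
  have ax: "arccot x = \<alpha>" unfolding x_def using \<alpha> \<phi> by (intro arccot_cot) auto
  have "(Re b + 1) / Im b \<le> x" using ge unfolding ax[symmetric]
    by (simp add: arccot_less_iff flip: not_less)
  \<comment> \<open>The failed inequality is what gives the bound 1, hence
    \<open>t \<le> 1\<close>.\<close>
  then have x: "x * Im b - Re b \<ge> 1" using b by (simp add: field_simps)
  then have t: "0 < t" "t \<le> 1" by (auto simp: t_def inverse_le_1_iff)
  define b' where "b' = of_real t * b"
  have b': "Im b' > 0" using b t by (simp add: b'_def)
  have "Re b' + 1 = x * Im b'" using x by (simp add: b'_def t_def field_simps)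
  then have "(Re b' + 1) / Im b' = x" using b' by simp
  moreover have "Re b' / Im b' = Re b / Im b" using t by (simp add: b'_def)
  \<comment> \<open>The argument of \<open>1 + b'\<close> is \<open>\<alpha>\<close>, so the sine is
    taken at \<open>(m + 1) * \<alpha> - \<phi> = 0\<close>.\<close>
  ultimately have "Im ((1 + b') ^ (m + 1) * cnj b') = 0"
    unfolding Im_power_mult_cnj[OF b'] by (simp add: ax \<alpha>_def add.commute flip: \<phi>_def)
  then obtain w where "cmod w = 1" "power_sum m w = inverse b'"
    using Im_power_eq_0_imp_circle[OF b'] by blast
  then have "inverse b' \<in> power_sum m ` cball 0 1" by (metis image_eqI mem_cball_0 order_refl)
  from power_sum_image_starlike[OF m this t] have "of_real t * inverse b' \<in> power_sum m ` cball 0 1" .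
  moreover have "of_real t * inverse b' = inverse b" using t by (simp add: b'_def)
  ultimately show False using notin by simp
qed

section \<open>Both descriptions of the stable set, by rescaling\<close>

theorem theorem7p4:
  fixes m :: nat
  assumes "m \<ge> 1"
  shows "MARS_plus m =
           {a :: complex. (\<forall>l \<in> {0..m}. Im ((1 + a / of_nat m) ^ (l + 1) * cnj a) < 0) \<and> Im a > 0}
       \<and> {a :: complex. (\<forall>l \<in> {0..m}. Im ((1 + a / of_nat m) ^ (l + 1) * cnj a) < 0) \<and> Im a > 0} =
           {complex_of_real \<xi> + \<i> * complex_of_real \<eta> | \<xi> \<eta> :: real.
              \<eta> > 0 \<and> (real m + 1) * arccot ((\<xi> + real m) / \<eta>) < arccot (\<xi> / \<eta>)}"
    (is "_ = ?A \<and> _ = ?B")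
proof -
  have m0: "real m > 0" using assms by simp
  \<comment> \<open>The lemmas concern \<open>b = a / m\<close>; the positive factor
    \<open>m\<close> cancels in the quotients and does not affect the signs.\<close>
  have "(Re (a / of_nat m) + 1) / Im (a / of_nat m) =
      ((Re a + real m) / real m) / (Im a / real m)" for a
    using m0 by (simp add: add_divide_distrib)
  then have scale: "(Re (a / of_nat m) + 1) / Im (a / of_nat m) = (Re a + real m) / Im a"
    "Re (a / of_nat m) / Im (a / of_nat m) = Re a / Im a" for a
    using m0 by simp_all
  have Im_scale: "Im (c * cnj a) < 0 \<longleftrightarrow> Im (c * cnj (a / of_nat m)) < 0" for a c
    using m0 by (simp add: field_simps mult_less_0_iff)
  have pos: "Im (a / of_nat m) > 0" if "Im a > 0" for a using that m0 by simp
  have A: "a \<in> ?A \<longleftrightarrow> (real m + 1) * arccot ((Re a + real m) / Im a) < arccot (Re a / Im a)"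
    if "Im a > 0" for a
    using Im_power_less_0_iff[OF pos[OF that], of m] that
    unfolding mem_Collect_eq scale Im_scale[of _ a] by blast
  have "a \<in> MARS m \<longleftrightarrow> a \<in> ?A" if "Im a > 0" for a
  proof -
    define b where "b = a / of_nat m"
    have b: "Im b > 0" using pos[OF that] by (simp add: b_def)
    then have "b \<noteq> 0" by auto
    then have "b * v = 1 \<longleftrightarrow> inverse b = v" for v using inverse_unique by auto
    then have "a \<in> MARS m \<longleftrightarrow> inverse b \<notin> power_sum m ` cball 0 1"
      unfolding MARS_iff_power_sum[OF assms] b_def[symmetric] by blast
    also have "\<dots> \<longleftrightarrow> (real m + 1) * arccot ((Re b + 1) / Im b) < arccot (Re b / Im b)"
      using arccot_less_imp_inverse_notin_image[OF assms b]
        inverse_notin_image_imp_arccot_less[OF assms b] by blast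
    also have "\<dots> \<longleftrightarrow> a \<in> ?A" unfolding b_def scale A[OF that] ..
    finally show ?thesis .
  qed
  then have "MARS_plus m = ?A" by (auto simp: MARS_plus_def)
  moreover have "?A = ?B"
  proof (intro equalityI subsetI)
    fix a assume a: "a \<in> ?A"
    then have "Im a > 0" by simp
    with A[OF this] a show "a \<in> ?B"
      by (intro CollectI exI[of _ "Re a"] exI[of _ "Im a"]) (auto simp: complex_eq)
  next
    fix a assume "a \<in> ?B"
    then obtain \<xi> \<eta> where "a = complex_of_real \<xi> + \<i> * complex_of_real \<eta>" "\<eta> > 0"
      "(real m + 1) * arccot ((\<xi> + real m) / \<eta>) < arccot (\<xi> / \<eta>)" by blast
    then show "a \<in> ?A" using A[of a] by simp
  qed
  ultimately show ?thesis by simp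
qed

end
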